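(* Let $D=(d_{ij})$ be an $n\times n$ Euclidean distance matrix of embedding dimension $r=n-3$. If $D$ is in general position in $\mathbb{R}^r$, then every off-diagonal entry of $D$ is unyielding, and every two distinct off-diagonal entries of $D$ in the same column (row) are jointly yielding; i.e., for all distinct indices $i,j,k\in\{1,\ldots,n\}$, the entries $d_{ij}$ and $d_{ik}$ are jointly yielding.
   Context: An $n\times n$ real matrix $D=(d_{ij})$ is a Euclidean distance matrix (EDM) if there exist points $p^1,\ldots,p^n$ in some Euclidean space with $d_{ij}=\|p^i-p^j\|^2$ for all $i,j$; such points are generating points of $D$, and the dimension of their affine span is the embedding dimension $r$ of $D$ (the generating points can be taken in $\mathbb{R}^r$). For $i\ne j$, $E^{ij}$ is the $n\times n$ symmetric matrix with 1's in the $ij$th and $ji$th entries and 0's elsewhere. For an off-diagonal entry $d_{ij}$, let $[l_{ij},u_{ij}]$ (with $l_{ij}\le 0\le u_{ij}$) be the closed interval such that $D+tE^{ij}$ is an EDM if and only if $l_{ij}\le t\le u_{ij}$. The entry $d_{ij}$ is unyielding if $l_{ij}=u_{ij}=0$, and yielding otherwise. Two unyielding entries $d_{ij}$ and $d_{ik}$ ($i,j,k$ distinct) are jointly yielding if $D+t_1E^{ij}+t_2E^{ik}$ is an EDM for some nonzero scalars $t_1$ and $t_2$; otherwise they are jointly unyielding. Points $p^1,\ldots,p^n$ in $\mathbb{R}^r$ are in general position if every $r+1$ of them are affinely independent (as an indexed family). An EDM of embedding dimension $r$ is in general position if its generating points in $\mathbb{R}^r$ are in general position. *)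

theory Defs
  imports "Jordan_Normal_Form.DL_Rank"
begin

text \<open>
  Indices run over \<open>0, \<dots>, n - 1\<close>, and \<open>\<real>\<^sup>m\<close> is \<open>carrier_vec m\<close>; the case \<open>m = 0\<close> is
  included. A family of \<open>n\<close> points in \<open>\<real>\<^sup>m\<close> is a function \<open>p\<close>, of which only the values
  at indices below \<open>n\<close> matter.
\<close>

definition generating_points :: "nat \<Rightarrow> nat \<Rightarrow> real mat \<Rightarrow> (nat \<Rightarrow> real vec) \<Rightarrow> bool" where
  "generating_points n m D p \<longleftrightarrow>
     D \<in> carrier_mat n n \<and>
     (\<forall>i<n. p i \<in> carrier_vec m) \<and>
     (\<forall>i<n. \<forall>j<n. D $$ (i, j) = (p i - p j) \<bullet> (p i - p j))"

definition EDM :: "nat \<Rightarrow> real mat \<Rightarrow> bool" where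
  "EDM n D \<longleftrightarrow> (\<exists>m p. generating_points n m D p)"

text \<open>
  The dimension of the affine span of \<open>p 0, \<dots>, p (n - 1)\<close> (for \<open>n \<ge> 1\<close>) is the dimension
  of its direction space, which is the linear span of the differences \<open>p i - p 0\<close>.
\<close>

definition affine_span_dim :: "nat \<Rightarrow> nat \<Rightarrow> (nat \<Rightarrow> real vec) \<Rightarrow> nat" where
  "affine_span_dim n m p = vec_space.rank m (mat_of_cols m (map (\<lambda>i. p i - p 0) [0..<n]))"

text \<open>
  Any two families of generating points of \<open>D\<close> differ by an isometry of their affine spans,
  so the value described here is unique.
\<close>

definition embedding_dim :: "nat \<Rightarrow> real mat \<Rightarrow> nat" where
  "embedding_dim n D = (THE r. \<exists>m p. generating_points n m D p \<and> affine_span_dim n m p = r)"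

definition affinely_independent_family ::
    "nat \<Rightarrow> nat set \<Rightarrow> (nat \<Rightarrow> real vec) \<Rightarrow> bool" where
  "affinely_independent_family m S p \<longleftrightarrow>
     (\<forall>c :: nat \<Rightarrow> real.
        (\<Sum>i\<in>S. c i) = 0 \<and> finsum_vec TYPE(real) m (\<lambda>i. c i \<cdot>\<^sub>v p i) S = 0\<^sub>v m
        \<longrightarrow> (\<forall>i\<in>S. c i = 0))"

definition points_in_general_position :: "nat \<Rightarrow> nat \<Rightarrow> (nat \<Rightarrow> real vec) \<Rightarrow> bool" where
  "points_in_general_position n r p \<longleftrightarrow>
     (\<forall>S. S \<subseteq> {..<n} \<and> card S = r + 1 \<longrightarrow> affinely_independent_family r S p)"

text \<open>
  Generating points of \<open>D\<close> in \<open>\<real>\<^sup>r\<close>, \<open>r\<close> the embedding dimension, exist and are unique up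
  to an isometry of \<open>\<real>\<^sup>r\<close>, so it does not matter which ones are taken.
\<close>

definition EDM_in_general_position :: "nat \<Rightarrow> real mat \<Rightarrow> bool" where
  "EDM_in_general_position n D \<longleftrightarrow>
     (\<exists>p. generating_points n (embedding_dim n D) D p \<and>
          points_in_general_position n (embedding_dim n D) p)"

definition E_mat :: "nat \<Rightarrow> nat \<Rightarrow> nat \<Rightarrow> real mat" where
  "E_mat n i j = mat n n (\<lambda>(a, b). if a = i \<and> b = j \<or> a = j \<and> b = i then 1 else 0)"

definition yielding_interval ::
    "nat \<Rightarrow> real mat \<Rightarrow> nat \<Rightarrow> nat \<Rightarrow> real \<Rightarrow> real \<Rightarrow> bool" where
  "yielding_interval n D i j l u \<longleftrightarrow>
     l \<le> 0 \<and> 0 \<le> u \<and> (\<forall>t. EDM n (D + t \<cdot>\<^sub>m E_mat n i j) \<longleftrightarrow> l \<le> t \<and> t \<le> u)"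

definition unyielding :: "nat \<Rightarrow> real mat \<Rightarrow> nat \<Rightarrow> nat \<Rightarrow> bool" where
  "unyielding n D i j \<longleftrightarrow> (\<exists>l u. yielding_interval n D i j l u \<and> l = 0 \<and> u = 0)"

definition jointly_yielding :: "nat \<Rightarrow> real mat \<Rightarrow> nat \<Rightarrow> nat \<Rightarrow> nat \<Rightarrow> bool" where
  "jointly_yielding n D i j k \<longleftrightarrow>
     unyielding n D i j \<and> unyielding n D i k \<and>
     (\<exists>t1 t2. t1 \<noteq> 0 \<and> t2 \<noteq> 0 \<and> EDM n (D + t1 \<cdot>\<^sub>m E_mat n i j + t2 \<cdot>\<^sub>m E_mat n i k))"

end

theory Submission
  imports Defs
begin

text \<open>
  Write \<open>r\<close> for the embedding dimension, so that there are \<open>r + 3\<close> points \<open>p\<^sub>a\<close> in \<open>\<real>\<^sup>r\<close>, any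
  \<open>r + 1\<close> of which form an affine basis.

  \<^emph>\<open>Unyielding.\<close> If \<open>D\<close> is an EDM and \<open>\<Sum>\<^sub>a x\<^sub>a = 0\<close>, then \<open>\<Sum>\<^sub>a\<^sub>b x\<^sub>a x\<^sub>b d\<^sub>a\<^sub>b = -2 \<bar>\<Sum>\<^sub>a x\<^sub>a p\<^sub>a\<bar>\<^sup>2 \<le> 0\<close>, with
  equality exactly when \<open>x\<close> is an affine dependence of the points. Hence, if \<open>D + t E\<^sup>i\<^sup>j\<close> is an
  EDM, every affine dependence \<open>x\<close> of the points of \<open>D\<close> satisfies \<open>2 t x\<^sub>i x\<^sub>j \<le> 0\<close>. Now \<open>p\<^sub>i\<close> and
  \<open>p\<^sub>j\<close> are both affine combinations of the \<open>r + 1\<close> remaining points; this gives a dependence \<open>v\<close>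
  with \<open>v\<^sub>i = 1\<close>, \<open>v\<^sub>j = 0\<close> and a dependence \<open>u\<close> with \<open>u\<^sub>i = 0\<close>, \<open>u\<^sub>j = 1\<close>. Taking \<open>x = u + v\<close> and
  \<open>x = u - v\<close> yields \<open>t \<le> 0\<close> and \<open>t \<ge> 0\<close>.

  \<^emph>\<open>Jointly yielding.\<close> Only the vertex \<open>p\<^sub>i\<close> has to move, into one extra dimension, so that its
  distances to all points but \<open>p\<^sub>j\<close> and \<open>p\<^sub>k\<close> are kept. Let \<open>f\<close> be the affine function on \<open>\<real>\<^sup>r\<close> with
  \<open>f (p\<^sub>i) = 0\<close> and \<open>f (p\<^sub>a) = 1\<close> for the \<open>r\<close> points with \<open>a \<notin> {i, j, k}\<close>. Moving \<open>p\<^sub>i\<close> a little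
  along the gradient of \<open>f\<close>, and then suitably far in the new direction, adds a fixed positive
  multiple of \<open>1 - f (p\<^sub>a)\<close> to each squared distance \<open>d\<^sub>i\<^sub>a\<close>. This is \<open>0\<close> for \<open>a \<notin> {i, j, k}\<close>. It
  is nonzero for \<open>a = j\<close>: otherwise \<open>f - 1\<close> would vanish at the \<open>r + 1\<close> points other than
  \<open>p\<^sub>i\<close> and \<open>p\<^sub>k\<close>, hence identically, contradicting \<open>f (p\<^sub>i) = 0\<close>. The same holds for \<open>a = k\<close>.
\<close>

section \<open>Affine bases\<close>

text \<open>
  Rows and columns of a nonsingular square matrix both span: the two conclusions solve the
  system for the matrix \<open>f\<close> and for its transpose.
\<close>

lemma independent_square_system_solvable:
  fixes f :: "'a \<Rightarrow> nat \<Rightarrow> real"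
  assumes fin: "finite S" and card: "card S = N"
    and ind: "\<And>c. (\<forall>j<N. (\<Sum>a\<in>S. c a * f a j) = 0) \<Longrightarrow> \<forall>a\<in>S. c a = 0"
  shows "\<exists>c. \<forall>j<N. (\<Sum>a\<in>S. c a * f a j) = y j"
    and "\<exists>g. \<forall>a\<in>S. (\<Sum>j<N. g j * f a j) = b a"
proof -
  obtain e where e: "bij_betw e {0..<N} S"
    using ex_bij_betw_nat_finite[OF fin] card by auto
  define e' where "e' = the_inv_into {0..<N} e"
  have e'e: "e' (e i) = i" if "i < N" for i
    using e that by (auto simp: e'_def bij_betw_def the_inv_into_f_f)
  have reindex: "(\<Sum>a\<in>S. F a) = (\<Sum>i\<in>{0..<N}. F (e i))" for F :: "'a \<Rightarrow> real"
    using sum.reindex_bij_betw[OF e, of F] by simp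
  define M where "M = mat N N (\<lambda>(j, i). f (e i) j)"
  have M: "M \<in> carrier_mat N N" by (simp add: M_def)
  have Mv: "(M *\<^sub>v v) $ j = (\<Sum>a\<in>S. v $ (e' a) * f a j)"
    if "v \<in> carrier_vec N" "j < N" for v j
    using that by (simp add: reindex M_def scalar_prod_def e'e mult.commute)
  have "det M \<noteq> 0"
  proof
    assume "det M = 0"
    then obtain v where v: "v \<in> carrier_vec N" "v \<noteq> 0\<^sub>v N" "M *\<^sub>v v = 0\<^sub>v N"
      using det_0_iff_vec_prod_zero[OF M] by auto
    have "\<forall>a\<in>S. v $ (e' a) = 0"
      using v Mv[OF v(1)] by (intro ind) auto
    then have "v $ i = 0" if "i < N" for i
      using that e e'e[OF that] by (metis atLeastLessThan_iff bij_betwE zero_le)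
    then have "v = 0\<^sub>v N" using v(1) by (intro eq_vecI) auto
    with v(2) show False by simp
  qed
  then obtain W where W: "W \<in> carrier_mat N N" and MW: "M * W = 1\<^sub>m N" and WM: "W * M = 1\<^sub>m N"
    using det_non_zero_imp_unit[OF M, of "()"]
    by (auto simp: Units_def ring_mat_def)
  show "\<exists>c. \<forall>j<N. (\<Sum>a\<in>S. c a * f a j) = y j"
  proof (intro exI allI impI)
    fix j assume j: "j < N"
    have "M *\<^sub>v (W *\<^sub>v vec N y) = vec N y"
      using M W MW by (subst assoc_mult_mat_vec[symmetric, where n\<^sub>2 = N]) auto
    then show "(\<Sum>a\<in>S. (W *\<^sub>v vec N y) $ (e' a) * f a j) = y j"
      using Mv[of "W *\<^sub>v vec N y" j] W j by simp
  qed
  show "\<exists>g. \<forall>a\<in>S. (\<Sum>j<N. g j * f a j) = b a"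
  proof (intro exI ballI)
    fix a assume "a \<in> S"
    then obtain i where i: "i < N" "a = e i"
      using e by (auto simp: bij_betw_def)
    let ?z = "vec N (\<lambda>i. b (e i))"
    let ?g = "W\<^sup>T *\<^sub>v ?z"
    have "M\<^sup>T *\<^sub>v ?g = (W * M)\<^sup>T *\<^sub>v ?z"
      using M W
      by (subst assoc_mult_mat_vec[symmetric, where n\<^sub>2 = N]) (auto simp: transpose_mult)
    then have "(M\<^sup>T *\<^sub>v ?g) $ i = b a"
      using i by (simp add: WM)
    moreover have "(M\<^sup>T *\<^sub>v ?g) $ i = (\<Sum>j<N. ?g $ j * f a j)"
      using i W by (simp add: M_def scalar_prod_def mult.commute atLeast0LessThan)
    ultimately show "(\<Sum>j<N. ?g $ j * f a j) = b a" by simp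
  qed
qed

text \<open>
  Affine independence of points is linear independence of their homogeneous coordinates
  \<open>(1, p\<^sub>a)\<close>.
\<close>

lemma affine_basis_solvable:
  assumes fin: "finite S" and card: "card S = r + 1"
    and p: "\<And>a. a \<in> S \<Longrightarrow> p a \<in> carrier_vec r"
    and indep: "affinely_independent_family r S p"
  shows affine_combination_exists:
      "\<exists>c. (\<Sum>a\<in>S. c a) = 1 \<and> (\<forall>l<r. (\<Sum>a\<in>S. c a * p a $ l) = q $ l)"
    and affine_interpolation:
      "\<exists>\<beta> g. \<forall>a\<in>S. \<beta> + (\<Sum>l<r. g l * p a $ l) = (b a :: real)"
proof -
  define f where "f a l = (case l of 0 \<Rightarrow> 1 | Suc l' \<Rightarrow> p a $ l')" for a l
  have ind: "\<forall>a\<in>S. c a = 0" if "\<forall>j<r + 1. (\<Sum>a\<in>S. c a * f a j) = 0" for c :: "nat \<Rightarrow> real"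
  proof -
    have c0: "(\<Sum>a\<in>S. c a) = 0" using that[rule_format, of 0] by (simp add: f_def)
    have coord: "(\<Sum>a\<in>S. c a * p a $ l) = 0" if "l < r" for l
      using \<open>\<forall>j<r + 1. _\<close>[rule_format, of "Suc l"] that by (simp add: f_def)
    have comb: "finsum_vec TYPE(real) r (\<lambda>i. c i \<cdot>\<^sub>v p i) S = 0\<^sub>v r"
    proof (intro eq_vecI)
      fix l assume "l < dim_vec (0\<^sub>v r :: real vec)"
      then have l: "l < r" by simp
      have "finsum_vec TYPE(real) r (\<lambda>i. c i \<cdot>\<^sub>v p i) S $ l = (\<Sum>a\<in>S. (c a \<cdot>\<^sub>v p a) $ l)"
        using p l by (intro index_finsum_vec[OF fin]) auto
      also have "\<dots> = (\<Sum>a\<in>S. c a * p a $ l)"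
      proof (intro sum.cong refl)
        fix a assume "a \<in> S"
        with p have "dim_vec (p a) = r" by (intro carrier_vecD)
        with l show "(c a \<cdot>\<^sub>v p a) $ l = c a * p a $ l" by simp
      qed
      finally show "finsum_vec TYPE(real) r (\<lambda>i. c i \<cdot>\<^sub>v p i) S $ l = 0\<^sub>v r $ l"
        using coord l by simp
    next
      show "dim_vec (finsum_vec TYPE(real) r (\<lambda>i. c i \<cdot>\<^sub>v p i) S) = dim_vec (0\<^sub>v r :: real vec)"
        using p finsum_vec_closed[of "\<lambda>i. c i \<cdot>\<^sub>v p i" S r] by (auto intro: carrier_vecD)
    qed
    show ?thesis
      using c0 comb indep unfolding affinely_independent_family_def by blast
  qed
  obtain c where c: "\<forall>j<r + 1. (\<Sum>a\<in>S. c a * f a j) = (case j of 0 \<Rightarrow> 1 | Suc l \<Rightarrow> q $ l)"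
    using independent_square_system_solvable(1)[OF fin card ind] by blast
  have "(\<Sum>a\<in>S. c a) = 1" using c[rule_format, of 0] by (simp add: f_def)
  moreover have "(\<Sum>a\<in>S. c a * p a $ l) = q $ l" if "l < r" for l
    using c[rule_format, of "Suc l"] that by (simp add: f_def)
  ultimately show "\<exists>c. (\<Sum>a\<in>S. c a) = 1 \<and> (\<forall>l<r. (\<Sum>a\<in>S. c a * p a $ l) = q $ l)"
    by blast
  obtain g where g: "\<forall>a\<in>S. (\<Sum>j<r + 1. g j * f a j) = b a"
    using independent_square_system_solvable(2)[OF fin card ind] by blast
  then have "\<forall>a\<in>S. g 0 + (\<Sum>l<r. g (Suc l) * p a $ l) = b a"
    by (simp add: f_def sum.lessThan_Suc_shift del: sum.lessThan_Suc)
  then show "\<exists>\<beta> g. \<forall>a\<in>S. \<beta> + (\<Sum>l<r. g l * p a $ l) = b a"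
    by (intro exI)
qed

lemma affine_function_constant_if_constant_on_affine_basis:
  fixes \<beta> d :: real
  assumes "finite S" "card S = r + 1" "\<And>a. a \<in> S \<Longrightarrow> p a \<in> carrier_vec r"
    and "affinely_independent_family r S p"
    and const: "\<And>a. a \<in> S \<Longrightarrow> \<beta> + (\<Sum>l<r. g l * p a $ l) = d"
  shows "\<beta> + (\<Sum>l<r. g l * q $ l) = d"
proof -
  obtain c where c1: "(\<Sum>a\<in>S. c a) = 1"
    and cq: "\<And>l. l < r \<Longrightarrow> (\<Sum>a\<in>S. c a * p a $ l) = q $ l"
    using affine_combination_exists[OF assms(1-4)] by blast
  have "d = (\<Sum>a\<in>S. c a * (\<beta> + (\<Sum>l<r. g l * p a $ l)))"
    using c1 const by (simp flip: sum_distrib_right)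
  also have "\<dots> = \<beta> * (\<Sum>a\<in>S. c a) + (\<Sum>a\<in>S. \<Sum>l<r. g l * (c a * p a $ l))"
    by (simp add: algebra_simps sum.distrib sum_distrib_left)
  also have "(\<Sum>a\<in>S. \<Sum>l<r. g l * (c a * p a $ l)) = (\<Sum>l<r. g l * (\<Sum>a\<in>S. c a * p a $ l))"
    by (subst sum.swap) (simp add: sum_distrib_left)
  finally show ?thesis using c1 cq by simp
qed

section \<open>The quadratic form of a Euclidean distance matrix\<close>

lemma generating_points_entry:
  assumes "generating_points n m D p" "a < n" "b < n"
  shows "D $$ (a, b) = (\<Sum>l<m. (p a $ l - p b $ l)\<^sup>2)"
proof -
  have "p a \<in> carrier_vec m" "p b \<in> carrier_vec m"
    using assms by (auto simp: generating_points_def)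
  moreover have "D $$ (a, b) = (p a - p b) \<bullet> (p a - p b)"
    using assms by (auto simp: generating_points_def)
  ultimately show ?thesis
    by (simp add: scalar_prod_def power2_eq_square atLeast0LessThan)
qed

lemma generating_points_entry_refl:
  assumes "generating_points n m D p" "a < n"
  shows "D $$ (a, a) = 0"
  using generating_points_entry[OF assms(1,2,2)] by simp

lemma sum_squared_differences_weighted:
  fixes x y :: "'a \<Rightarrow> real"
  assumes "(\<Sum>a\<in>S. x a) = 0"
  shows "(\<Sum>a\<in>S. \<Sum>b\<in>S. x a * x b * (y a - y b)\<^sup>2) = - 2 * (\<Sum>a\<in>S. x a * y a)\<^sup>2"
proof -
  have "(\<Sum>a\<in>S. \<Sum>b\<in>S. x a * x b * (y a - y b)\<^sup>2)
      = (\<Sum>a\<in>S. \<Sum>b\<in>S. (x a * (y a)\<^sup>2) * x b + x a * (x b * (y b)\<^sup>2)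
          - 2 * ((x a * y a) * (x b * y b)))"
    by (intro sum.cong refl) (simp add: power2_eq_square algebra_simps)
  also have "\<dots> = (\<Sum>a\<in>S. \<Sum>b\<in>S. (x a * (y a)\<^sup>2) * x b)
      + (\<Sum>a\<in>S. \<Sum>b\<in>S. x a * (x b * (y b)\<^sup>2))
      - 2 * (\<Sum>a\<in>S. \<Sum>b\<in>S. (x a * y a) * (x b * y b))"
    by (simp only: sum.distrib sum_subtractf sum_distrib_left)
  also have "\<dots> = - 2 * (\<Sum>a\<in>S. x a * y a)\<^sup>2"
    using assms by (simp only: sum_product[symmetric]) (simp add: power2_eq_square)
  finally show ?thesis .
qed

lemma generating_points_quadratic_form:
  assumes gen: "generating_points n m D p" and x: "(\<Sum>a<n. x a) = 0"
  shows "(\<Sum>a<n. \<Sum>b<n. x a * x b * D $$ (a, b)) = - 2 * (\<Sum>l<m. (\<Sum>a<n. x a * p a $ l)\<^sup>2)"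
proof -
  have "(\<Sum>a<n. \<Sum>b<n. x a * x b * D $$ (a, b))
      = (\<Sum>a<n. \<Sum>b<n. \<Sum>l<m. x a * x b * (p a $ l - p b $ l)\<^sup>2)"
    using generating_points_entry[OF gen] by (simp add: sum_distrib_left)
  also have "\<dots> = (\<Sum>a<n. \<Sum>l<m. \<Sum>b<n. x a * x b * (p a $ l - p b $ l)\<^sup>2)"
    by (rule sum.cong[OF refl]) (rule sum.swap)
  also have "\<dots> = (\<Sum>l<m. \<Sum>a<n. \<Sum>b<n. x a * x b * (p a $ l - p b $ l)\<^sup>2)"
    by (rule sum.swap)
  also have "\<dots> = - 2 * (\<Sum>l<m. (\<Sum>a<n. x a * p a $ l)\<^sup>2)"
    using x by (simp add: sum_squared_differences_weighted sum_distrib_left)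
  finally show ?thesis .
qed

lemma E_mat_quadratic_form:
  assumes "i < n" "j < n" "i \<noteq> j"
  shows "(\<Sum>a<n. \<Sum>b<n. x a * x b * E_mat n i j $$ (a, b)) = 2 * x i * x j"
proof -
  have "(\<Sum>a<n. \<Sum>b<n. x a * x b * E_mat n i j $$ (a, b))
      = (\<Sum>a<n. \<Sum>b<n. (if b = j then if a = i then x i * x j else 0 else 0)
          + (if b = i then if a = j then x i * x j else 0 else 0))"
    using assms by (intro sum.cong refl) (auto simp: E_mat_def)
  also have "\<dots> = 2 * x i * x j"
    using assms by (simp add: sum.distrib sum.delta)
  finally show ?thesis .
qed

text \<open>
  On an affine dependence the form of \<open>D\<close> vanishes, so there the sign of the form of a
  perturbed matrix is the sign of the perturbation.
\<close>

lemma EDM_perturbation_on_affine_dependence: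
  assumes gen: "generating_points n m D p" and ij: "i < n" "j < n" "i \<noteq> j"
    and edm: "EDM n (D + t \<cdot>\<^sub>m E_mat n i j)"
    and x: "(\<Sum>a<n. x a) = 0" "\<And>l. l < m \<Longrightarrow> (\<Sum>a<n. x a * p a $ l) = 0"
  shows "t * (x i * x j) \<le> 0"
proof -
  have D: "D \<in> carrier_mat n n" using gen by (simp add: generating_points_def)
  obtain m' p' where gen': "generating_points n m' (D + t \<cdot>\<^sub>m E_mat n i j) p'"
    using edm by (auto simp: EDM_def)
  have "(\<Sum>a<n. \<Sum>b<n. x a * x b * (D + t \<cdot>\<^sub>m E_mat n i j) $$ (a, b))
      = (\<Sum>a<n. \<Sum>b<n. x a * x b * D $$ (a, b) + t * (x a * x b * E_mat n i j $$ (a, b)))"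
    using D by (intro sum.cong refl) (simp add: E_mat_def distrib_left)
  also have "\<dots> = (\<Sum>a<n. \<Sum>b<n. x a * x b * D $$ (a, b))
        + t * (\<Sum>a<n. \<Sum>b<n. x a * x b * E_mat n i j $$ (a, b))"
    by (simp only: sum.distrib sum_distrib_left)
  also have "\<dots> = 2 * (t * (x i * x j))"
    using generating_points_quadratic_form[OF gen x(1)] x(2) E_mat_quadratic_form[OF ij]
    by simp
  finally show ?thesis
    using generating_points_quadratic_form[OF gen' x(1)]
      sum_nonneg[of "{..<m'}" "\<lambda>l. (\<Sum>a<n. x a * p' a $ l)\<^sup>2"] by simp
qed

section \<open>Unyielding entries\<close>

lemma affine_dependence_from_combination:
  fixes n r :: nat
  assumes card: "card S = r + 1" and S: "S \<subseteq> {..<n}" and k: "k < n" "k \<notin> S"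
    and p: "\<And>a. a < n \<Longrightarrow> p a \<in> carrier_vec r" and indep: "affinely_independent_family r S p"
  obtains u :: "nat \<Rightarrow> real" where "u k = 1" "\<And>a. a \<notin> S \<Longrightarrow> a \<noteq> k \<Longrightarrow> u a = 0"
    "(\<Sum>a<n. u a) = 0" "\<And>l. l < r \<Longrightarrow> (\<Sum>a<n. u a * p a $ l) = 0"
proof -
  have fin: "finite S" using S finite_subset by blast
  have "\<And>a. a \<in> S \<Longrightarrow> p a \<in> carrier_vec r" using p S by auto
  from affine_combination_exists[OF fin card this indep] obtain c
    where c: "(\<Sum>a\<in>S. c a) = 1" "\<And>l. l < r \<Longrightarrow> (\<Sum>a\<in>S. c a * p a $ l) = p k $ l"
    by blast
  define u where "u a = (if a = k then 1 else if a \<in> S then - c a else 0)" for a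
  have *: "(\<Sum>a<n. u a * F a) = F k - (\<Sum>a\<in>S. c a * F a)" for F
  proof -
    have "(\<Sum>a<n. u a * F a) = (\<Sum>a\<in>insert k S. u a * F a)"
      using S k by (intro sum.mono_neutral_right) (auto simp: u_def)
    also have "\<dots> = F k + (\<Sum>a\<in>S. u a * F a)"
      using k fin by (simp add: u_def)
    also have "(\<Sum>a\<in>S. u a * F a) = (\<Sum>a\<in>S. - (c a * F a))"
      using k by (intro sum.cong) (auto simp: u_def)
    finally show ?thesis by (simp add: sum_negf)
  qed
  show thesis
    using c *[of "\<lambda>_. 1"] * by (intro that[of u]) (auto simp: u_def)
qed

lemma general_position_unyielding:
  assumes n: "n = r + 3" and gen: "generating_points n r D p"
    and gp: "points_in_general_position n r p"
    and ij: "i < n" "j < n" "i \<noteq> j"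
  shows "unyielding n D i j"
proof -
  have D: "D \<in> carrier_mat n n" and p: "\<And>a. a < n \<Longrightarrow> p a \<in> carrier_vec r"
    using gen by (auto simp: generating_points_def)
  let ?S = "{..<n} - {i, j}"
  have card: "card ?S = r + 1" using n ij by (simp add: card_Diff_subset)
  have indep: "affinely_independent_family r ?S p"
    using gp card by (auto simp: points_in_general_position_def)
  obtain u where u: "u j = 1" "\<And>a. a \<notin> ?S \<Longrightarrow> a \<noteq> j \<Longrightarrow> u a = 0"
    "(\<Sum>a<n. u a) = 0" "\<And>l. l < r \<Longrightarrow> (\<Sum>a<n. u a * p a $ l) = 0"
    using affine_dependence_from_combination[OF card _ ij(2) _ p indep] by auto
  obtain v where v: "v i = 1" "\<And>a. a \<notin> ?S \<Longrightarrow> a \<noteq> i \<Longrightarrow> v a = 0"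
    "(\<Sum>a<n. v a) = 0" "\<And>l. l < r \<Longrightarrow> (\<Sum>a<n. v a * p a $ l) = 0"
    using affine_dependence_from_combination[OF card _ ij(1) _ p indep] by auto
  have uv: "u i = 0" "v j = 0" using u(2)[of i] v(2)[of j] ij by auto
  have "t = 0" if edm: "EDM n (D + t \<cdot>\<^sub>m E_mat n i j)" for t
  proof -
    have "t * ((u i + v i) * (u j + v j)) \<le> 0"
      using u v
      by (intro EDM_perturbation_on_affine_dependence[OF gen ij edm])
        (auto simp: sum.distrib distrib_right)
    moreover have "t * ((u i - v i) * (u j - v j)) \<le> 0"
      using u v
      by (intro EDM_perturbation_on_affine_dependence[OF gen ij edm])
        (auto simp: sum_subtractf left_diff_distrib)
    ultimately show ?thesis using u(1) v(1) uv by simp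
  qed
  moreover have "EDM n (D + 0 \<cdot>\<^sub>m E_mat n i j)"
  proof -
    have "D + 0 \<cdot>\<^sub>m E_mat n i j = D"
      using D by (intro eq_matI) (auto simp: E_mat_def)
    then show ?thesis using gen by (auto simp: EDM_def)
  qed
  ultimately have "yielding_interval n D i j 0 0"
    unfolding yielding_interval_def by (metis order.antisym order.refl)
  then show ?thesis unfolding unyielding_def by blast
qed

section \<open>Jointly yielding entries\<close>

text \<open>
  With \<open>f (x) = \<beta> + \<langle>g, x\<rangle>\<close> and \<open>f (p\<^sub>i) = 0\<close>, the vertex \<open>p\<^sub>i\<close> is replaced by \<open>p\<^sub>i + \<kappa> g\<close> at
  height \<open>s\<close> above \<open>\<real>\<^sup>m\<close>. Its squared distance to \<open>p\<^sub>a\<close> grows by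
  \<open>2 \<kappa> \<langle>g, p\<^sub>i - p\<^sub>a\<rangle> + \<kappa>\<^sup>2 \<bar>g\<bar>\<^sup>2 + s\<^sup>2 = 2 \<kappa> (1 - f (p\<^sub>a))\<close> if \<open>s\<^sup>2 = 2 \<kappa> - \<kappa>\<^sup>2 \<bar>g\<bar>\<^sup>2\<close>, and the
  right-hand side of the latter is nonnegative for small \<open>\<kappa> > 0\<close>.
\<close>

lemma EDM_lift_vertex:
  assumes gen: "generating_points n m D p" and i: "i < n"
    and f: "\<And>a. f a = \<beta> + (\<Sum>l<m. g l * p a $ l)" and fi: "f i = 0"
  shows "\<exists>\<kappa>>0. EDM n (mat n n (\<lambda>(a, b). D $$ (a, b) +
           (if a = b then 0 else if a = i then 2 * \<kappa> * (1 - f b)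
            else if b = i then 2 * \<kappa> * (1 - f a) else 0)))"
proof -
  define G where "G = (\<Sum>l<m. (g l)\<^sup>2)"
  have G0: "G \<ge> 0" by (simp add: G_def sum_nonneg)
  \<comment> \<open>Any \<open>\<kappa> > 0\<close> with \<open>\<kappa> G \<le> 2\<close> would do; \<open>G + 1\<close> avoids a case distinction on \<open>G = 0\<close>.\<close>
  define \<kappa> where "\<kappa> = 1 / (G + 1)"
  have k0: "\<kappa> > 0" using G0 by (simp add: \<kappa>_def)
  have "\<kappa> * G \<le> 2" using G0 by (simp add: \<kappa>_def field_simps)
  then have "\<kappa> * (2 - \<kappa> * G) \<ge> 0" using k0 by simp
  then have s0: "2 * \<kappa> - \<kappa>\<^sup>2 * G \<ge> 0" by (simp add: power2_eq_square algebra_simps)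
  define s where "s = sqrt (2 * \<kappa> - \<kappa>\<^sup>2 * G)"
  have s2: "s\<^sup>2 = 2 * \<kappa> - \<kappa>\<^sup>2 * G" using s0 by (simp add: s_def)
  define y where "y a = vec (Suc m) (\<lambda>l. if l < m then p a $ l + (if a = i then \<kappa> * g l else 0)
      else if a = i then s else 0)" for a
  have moved: "(\<Sum>l<m. (p i $ l + \<kappa> * g l - p a $ l)\<^sup>2) + s\<^sup>2 = D $$ (i, a) + 2 * \<kappa> * (1 - f a)"
    if a: "a < n" for a
  proof -
    have "(\<Sum>l<m. (p i $ l + \<kappa> * g l - p a $ l)\<^sup>2)
        = (\<Sum>l<m. (p i $ l - p a $ l)\<^sup>2 + 2 * \<kappa> * (g l * p i $ l - g l * p a $ l)
            + \<kappa>\<^sup>2 * (g l)\<^sup>2)"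
      by (intro sum.cong refl) (simp add: power2_eq_square algebra_simps)
    also have "\<dots> = (\<Sum>l<m. (p i $ l - p a $ l)\<^sup>2)
        + 2 * \<kappa> * ((\<Sum>l<m. g l * p i $ l) - (\<Sum>l<m. g l * p a $ l)) + \<kappa>\<^sup>2 * G"
      by (simp only: G_def sum.distrib sum_subtractf sum_distrib_left right_diff_distrib)
    also have "(\<Sum>l<m. g l * p i $ l) - (\<Sum>l<m. g l * p a $ l) = - f a"
      using f[of i] f[of a] fi by simp
    finally show ?thesis
      using generating_points_entry[OF gen i a] by (simp add: s2 algebra_simps)
  qed
  have sym: "(\<Sum>l<m. (p a $ l - (p i $ l + \<kappa> * g l))\<^sup>2) = (\<Sum>l<m. (p i $ l + \<kappa> * g l - p a $ l)\<^sup>2)"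
    for a by (intro sum.cong refl power2_commute)
  have symD: "D $$ (a, b) = D $$ (b, a)" if "a < n" "b < n" for a b
    using that generating_points_entry[OF gen] by (simp add: power2_commute)
  let ?D = "mat n n (\<lambda>(a, b). D $$ (a, b) +
           (if a = b then 0 else if a = i then 2 * \<kappa> * (1 - f b)
            else if b = i then 2 * \<kappa> * (1 - f a) else 0))"
  have "generating_points n (Suc m) ?D y"
    unfolding generating_points_def
  proof (intro conjI allI impI)
    fix a b assume ab: "a < n" "b < n"
    have sp: "(y a - y b) \<bullet> (y a - y b) = (\<Sum>l<Suc m. (y a $ l - y b $ l)\<^sup>2)"
      by (simp add: scalar_prod_def y_def power2_eq_square atLeast0LessThan del: sum.lessThan_Suc)
    show "?D $$ (a, b) = (y a - y b) \<bullet> (y a - y b)"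
    proof (cases "a = b")
      case True
      then show ?thesis using ab sp generating_points_entry_refl[OF gen] by simp
    next
      case False
      then consider "a = i" "b \<noteq> i" | "b = i" "a \<noteq> i" | "a \<noteq> i" "b \<noteq> i" by blast
      then show ?thesis
      proof cases
        case 1
        then show ?thesis using ab moved[OF ab(2)] unfolding sp by (simp add: y_def)
      next
        case 2
        then show ?thesis
          using ab moved[OF ab(1)] symD[OF ab] unfolding sp by (simp add: y_def sym)
      next
        case 3
        then show ?thesis
          using False ab generating_points_entry[OF gen ab] unfolding sp by (simp add: y_def)
      qed
    qed
  qed (auto simp: y_def)
  then show ?thesis using k0 by (auto simp: EDM_def)
qed

lemma general_position_jointly_yielding:
  assumes n: "n = r + 3" and gen: "generating_points n r D p"
    and gp: "points_in_general_position n r p"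
    and ijk: "i < n" "j < n" "k < n" "i \<noteq> j" "i \<noteq> k" "j \<noteq> k"
  shows "jointly_yielding n D i j k"
proof -
  have D: "D \<in> carrier_mat n n" and p: "\<And>a. a < n \<Longrightarrow> p a \<in> carrier_vec r"
    using gen by (auto simp: generating_points_def)
  have basis: "affinely_independent_family r ({..<n} - {a, b}) p"
      "card ({..<n} - {a, b}) = r + 1" if "a < n" "b < n" "a \<noteq> b" for a b
  proof -
    show card: "card ({..<n} - {a, b}) = r + 1"
      using n that by (simp add: card_Diff_subset)
    show "affinely_independent_family r ({..<n} - {a, b}) p"
      using gp card by (auto simp: points_in_general_position_def)
  qed
  let ?S = "{..<n} - {j, k}"
  obtain \<beta> g where interp:
    "\<And>a. a \<in> ?S \<Longrightarrow> \<beta> + (\<Sum>l<r. g l * p a $ l) = (if a = i then 0 else 1)"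
    using affine_interpolation[of ?S r p "\<lambda>a. if a = i then 0 else 1"] basis[OF ijk(2,3,6)] p
    by auto
  define f where "f a = \<beta> + (\<Sum>l<r. g l * p a $ l)" for a
  have fi: "f i = 0" and f1: "\<And>a. a < n \<Longrightarrow> a \<notin> {i, j, k} \<Longrightarrow> f a = 1"
    using interp ijk by (auto simp: f_def)
  have ne: "f a \<noteq> 1" if ab: "{a, b} = {j, k}" "a \<noteq> b" for a b
  proof
    assume fa: "f a = 1"
    have b: "b < n" "i \<noteq> b" using ab ijk by (auto simp: doubleton_eq_iff)
    have "f c = 1" if "c \<in> {..<n} - {i, b}" for c
    proof (cases "c = a")
      case False
      then show ?thesis using f1[of c] that ab by (auto simp: doubleton_eq_iff)
    qed (use fa in simp)
    then have "f i = 1"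
      unfolding f_def
      using affine_function_constant_if_constant_on_affine_basis[OF _
            basis(2)[OF ijk(1) b] _ basis(1)[OF ijk(1) b], of \<beta> g 1 "p i"] p by blast
    with fi show False by simp
  qed
  have fj: "f j \<noteq> 1" and fk: "f k \<noteq> 1" using ne[of j k] ne[of k j] ijk by auto
  obtain \<kappa> where k0: "\<kappa> > 0" and edm: "EDM n (mat n n (\<lambda>(a, b). D $$ (a, b) +
           (if a = b then 0 else if a = i then 2 * \<kappa> * (1 - f b)
            else if b = i then 2 * \<kappa> * (1 - f a) else 0)))" (is "EDM n ?D")
    using EDM_lift_vertex[OF gen ijk(1) f_def fi] by blast
  let ?t1 = "2 * \<kappa> * (1 - f j)" and ?t2 = "2 * \<kappa> * (1 - f k)"
  have "D + ?t1 \<cdot>\<^sub>m E_mat n i j + ?t2 \<cdot>\<^sub>m E_mat n i k = ?D"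
  proof (rule eq_matI)
    fix a b assume "a < dim_row ?D" "b < dim_col ?D"
    then have "a < n" "b < n" by auto
    then show "(D + ?t1 \<cdot>\<^sub>m E_mat n i j + ?t2 \<cdot>\<^sub>m E_mat n i k) $$ (a, b) = ?D $$ (a, b)"
      using D f1[of a] f1[of b] ijk by (auto simp: E_mat_def)
  qed (auto simp: E_mat_def)
  then have "EDM n (D + ?t1 \<cdot>\<^sub>m E_mat n i j + ?t2 \<cdot>\<^sub>m E_mat n i k)"
    using edm by simp
  moreover have "?t1 \<noteq> 0" "?t2 \<noteq> 0" using k0 fj fk by auto
  ultimately show ?thesis
    unfolding jointly_yielding_def
    using general_position_unyielding[OF n gen gp ijk(1,2,4)]
      general_position_unyielding[OF n gen gp ijk(1,3,5)] by blast
qed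

theorem corollary5p1:
  fixes n :: nat and D :: "real mat"
  assumes "EDM n D"
    and "n = embedding_dim n D + 3"
    and "EDM_in_general_position n D"
  shows "(\<forall>i<n. \<forall>j<n. i \<noteq> j \<longrightarrow> unyielding n D i j) \<and>
         (\<forall>i<n. \<forall>j<n. \<forall>k<n. i \<noteq> j \<and> i \<noteq> k \<and> j \<noteq> k \<longrightarrow> jointly_yielding n D i j k)"
proof -
  obtain p where "generating_points n (embedding_dim n D) D p"
    "points_in_general_position n (embedding_dim n D) p"
    using assms(3) by (auto simp: EDM_in_general_position_def)
  then show ?thesis
    using general_position_unyielding[OF assms(2)]
      general_position_jointly_yielding[OF assms(2)] by blast
qed

end
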